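(* Let $M \in \mathbb{R}^{m\times n}_+$ be a noiseless hyperspectral image with two endmembers satisfying the linear mixing model and the sum-to-one constraint; that is, $M = \widetilde{W}\widetilde{H}$ for some $\widetilde{W} \in \mathbb{R}^{m \times 2}_+$ and $\widetilde{H} \in \mathbb{R}^{2\times n}_+$ such that the entries of each column of $\widetilde{H}$ sum to one. Then the rank-two NMF algorithm described in the context, applied to $M$, computes an optimal rank-two NMF of $M$; that is, any pair $(W,H) \in \mathbb{R}^{m\times 2}_+ \times \mathbb{R}^{2 \times n}_+$ output by it satisfies $$\|M-WH\|_F^2 = \min_{P \in \mathbb{R}^{m \times 2},\, P \geq 0,\; Q \in \mathbb{R}^{2 \times n},\, Q \geq 0} \|M-PQ\|_F^2 .$$
   Context: Inequalities such as $P \ge 0$ between a matrix and zero are entrywise; $\mathbb{R}^{m\times n}_+$ is the set of entrywise nonnegative real $m \times n$ matrices; $\|\cdot\|_F$ is the Frobenius norm. $A(:,j)$ denotes the $j$-th column of $A$. The rank-two NMF algorithm takes as input $M \in \mathbb{R}^{m\times n}_+$ (with $m,n\ge 2$) and proceeds as follows (arbitrary choices are allowed whenever a minimizer, maximizer or SVD is not unique). 1. Compute a rank-two truncated singular value decomposition of $M$: $U \in \mathbb{R}^{m\times 2}$ with orthonormal columns (left singular vectors for the two largest singular values), $S \in \mathbb{R}^{2\times 2}$ diagonal with the two largest singular values $\sigma_1(M)\ge\sigma_2(M)$, and $V \in \mathbb{R}^{2\times n}$ with orthonormal rows (the corresponding right singular vectors), so that $USV$ is a best approximation of $M$ of rank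 at most two in Frobenius norm. 2. Let $X = SV = U^TM \in \mathbb{R}^{2\times n}$. 3. Extract two column indices $K=(k_1,k_2)$ from $X$ with the successive projection algorithm (SPA): choose $k_1 \in \operatorname{argmax}_j \|X(:,j)\|_2$; set $R = \left(I - \frac{X(:,k_1)X(:,k_1)^T}{\|X(:,k_1)\|_2^2}\right) X$ (with $R = X$ if $X(:,k_1)=0$); choose $k_2 \in \operatorname{argmax}_j \|R(:,j)\|_2$. 4. Let $W = \max(0, USV(:,K)) \in \mathbb{R}^{m \times 2}_+$, where the maximum is entrywise and $V(:,K)$ is the $2\times 2$ matrix with columns $V(:,k_1), V(:,k_2)$. 5. Let $H \in \operatorname{argmin}_{Y \in \mathbb{R}^{2\times n},\, Y \geq 0} \|M - WY\|_F^2$. Output $(W,H)$. *)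

theory Defs
  imports "HOL-Analysis.Analysis"
begin

text \<open>
  An \<open>m \<times> n\<close> matrix is of type \<^typ>\<open>real ^ 'n ^ 'm\<close>. The library order \<open>0 \<le> A\<close> on this type is
  entrywise, and the library norm is the Frobenius norm. The two elements of the index type
  \<^typ>\<open>2\<close> are \<open>1\<close> and \<open>2\<close>.
\<close>

lemma matrix_nonneg_iff:
  fixes A :: "real ^ 'n ^ 'm"
  shows "0 \<le> A \<longleftrightarrow> (\<forall>i j. 0 \<le> A $ i $ j)"
  by (simp add: less_eq_vec_def)

lemma power2_norm_matrix:
  fixes A :: "real ^ 'n ^ 'm"
  shows "(norm A)\<^sup>2 = (\<Sum>i\<in>UNIV. \<Sum>j\<in>UNIV. (A $ i $ j)\<^sup>2)"
  by (simp add: norm_vec_def L2_set_def sum_nonneg)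

text \<open>
  Thin singular value decomposition. Singular triples are indexed from \<open>0\<close> by natural numbers, so
  that the singular values can be listed in decreasing order; the values of \<open>u\<close>, \<open>\<sigma>\<close>, \<open>v\<close> from index
  \<open>min m n\<close> onwards are irrelevant.
\<close>

definition is_svd ::
    "real ^ 'n ^ 'm \<Rightarrow> (nat \<Rightarrow> real ^ 'm) \<Rightarrow> (nat \<Rightarrow> real) \<Rightarrow> (nat \<Rightarrow> real ^ 'n) \<Rightarrow> bool" where
  "is_svd M u \<sigma> v \<longleftrightarrow>
    (let r = min CARD('m) CARD('n) in
      (\<forall>i<r. \<forall>j<r. u i \<bullet> u j = (if i = j then 1 else 0)) \<and>
      (\<forall>i<r. \<forall>j<r. v i \<bullet> v j = (if i = j then 1 else 0)) \<and>
      (\<forall>i<r. 0 \<le> \<sigma> i) \<and>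
      (\<forall>i<r. \<forall>j<r. i \<le> j \<longrightarrow> \<sigma> j \<le> \<sigma> i) \<and>
      M = (\<chi> a b. \<Sum>i<r. \<sigma> i * u i $ a * v i $ b))"

text \<open>Meaningful only if both dimensions of \<open>M\<close> are at least two.\<close>

definition is_rank_two_svd ::
    "real ^ 'n ^ 'm \<Rightarrow> real ^ 2 ^ 'm \<Rightarrow> real ^ 2 ^ 2 \<Rightarrow> real ^ 'n ^ 2 \<Rightarrow> bool" where
  "is_rank_two_svd M U S V \<longleftrightarrow>
    (\<exists>u \<sigma> v. is_svd M u \<sigma> v \<and>
      column 1 U = u 0 \<and> column 2 U = u 1 \<and>
      S $ 1 $ 1 = \<sigma> 0 \<and> S $ 2 $ 2 = \<sigma> 1 \<and> S $ 1 $ 2 = 0 \<and> S $ 2 $ 1 = 0 \<and>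
      row 1 V = v 0 \<and> row 2 V = v 1)"

definition spa_residual :: "real ^ 'n ^ 'r \<Rightarrow> 'n \<Rightarrow> real ^ 'n ^ 'r" where
  "spa_residual X k =
    (let x = column k X in
      if x = 0 then X
      else (mat 1 - (\<chi> i j. x $ i * x $ j / (norm x)\<^sup>2)) ** X)"

definition spa_two :: "real ^ 'n ^ 'r \<Rightarrow> 'n \<Rightarrow> 'n \<Rightarrow> bool" where
  "spa_two X k1 k2 \<longleftrightarrow>
    is_arg_max (\<lambda>j. norm (column j X)) (\<lambda>_. True) k1 \<and>
    is_arg_max (\<lambda>j. norm (column j (spa_residual X k1))) (\<lambda>_. True) k2"

definition select_columns :: "real ^ 'n ^ 'r \<Rightarrow> 'n \<Rightarrow> 'n \<Rightarrow> real ^ 2 ^ 'r" where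
  "select_columns A k1 k2 = (\<chi> i j. A $ i $ (if j = 1 then k1 else k2))"

definition positive_part :: "real ^ 'n ^ 'm \<Rightarrow> real ^ 'n ^ 'm" where
  "positive_part A = (\<chi> i j. max 0 (A $ i $ j))"

text \<open>
  A relation rather than a function, since the decomposition, the maximizers and the minimizer
  need not be unique: \<open>(W, H)\<close> is a possible output on input \<open>M\<close>.
\<close>

definition rank_two_nmf_output ::
    "real ^ 'n ^ 'm \<Rightarrow> real ^ 2 ^ 'm \<Rightarrow> real ^ 'n ^ 2 \<Rightarrow> bool" where
  "rank_two_nmf_output M W H \<longleftrightarrow>
    (\<exists>U S V k1 k2.
      is_rank_two_svd M U S V \<and>
      spa_two (S ** V) k1 k2 \<and>
      W = positive_part (U ** S ** select_columns V k1 k2) \<and>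
      is_arg_min (\<lambda>Y. (norm (M - W ** Y))\<^sup>2) (\<lambda>Y. 0 \<le> Y) H)"

definition optimal_rank_two_nmf ::
    "real ^ 'n ^ 'm \<Rightarrow> real ^ 2 ^ 'm \<Rightarrow> real ^ 'n ^ 2 \<Rightarrow> bool" where
  "optimal_rank_two_nmf M W H \<longleftrightarrow>
    is_arg_min (\<lambda>(P, Q). (norm (M - P ** Q))\<^sup>2) (\<lambda>(P, Q). 0 \<le> P \<and> 0 \<le> Q) (W, H)"

end

theory Submission
  imports Defs
begin

text \<open>
  Since \<open>M\<close> has rank at most two, \<open>M = U X\<close> with \<open>X = S V\<close>, and the columns of \<open>X\<close> lie on a line
  segment. The norm is strictly convex, so the first index picked by SPA is an extreme column; the
  residuals are proportional to the signed distance from it along the segment, so the second index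
  is the opposite extreme. If the residuals all vanish, every column is a multiple of the first one.
  In either case the columns of \<open>M\<close> are nonnegative combinations of the two selected ones, whence
  \<open>M = W Y\<close> for some \<open>Y \<ge> 0\<close>, and the error is zero.
\<close>

section \<open>Matrices through their columns\<close>

lemma column_eq_iff: "A = B \<longleftrightarrow> (\<forall>j. column j A = column j B)"
  by (auto simp: column_def vec_eq_iff)

lemma column_matrix_mul:
  fixes A :: "'a::semiring_1 ^ 'k ^ 'm" and B :: "'a ^ 'n ^ 'k"
  shows "column j (A ** B) = A *v column j B"
  by (simp add: column_def matrix_matrix_mult_def matrix_vector_mult_def vec_eq_iff)

lemma matrix_vector_mult_2:
  fixes A :: "real ^ 2 ^ 'm"
  shows "A *v x = x $ 1 *\<^sub>R column 1 A + x $ 2 *\<^sub>R column 2 A"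
  by (simp add: matrix_vector_mult_def vec_eq_iff column_def sum_2 mult.commute)

lemma matrix_mul_select_columns:
  "A ** select_columns B k1 k2 = select_columns (A ** B) k1 k2"
  by (simp add: select_columns_def matrix_matrix_mult_def vec_eq_iff)

lemma column_select_columns:
  "column 1 (select_columns A k1 k2) = column k1 A"
  "column 2 (select_columns A k1 k2) = column k2 A"
  by (simp_all add: select_columns_def column_def)

lemma positive_part_nonneg:
  assumes "\<And>i j. 0 \<le> A $ i $ j"
  shows "positive_part A = A"
  using assms by (simp add: positive_part_def vec_eq_iff max_def)

text \<open>The rank-one matrix subtracted in \<open>spa_residual\<close> is the orthogonal
  projector onto the selected column. Written with vectors, the SPA step can be analysed in any real
  inner product space.\<close>

lemma column_spa_residual:
  fixes X :: "real ^ 'n ^ 'r"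
  assumes "column k X \<noteq> 0"
  shows "column j (spa_residual X k) =
    column j X - ((column k X \<bullet> column j X) / (norm (column k X))\<^sup>2) *\<^sub>R column k X"
proof -
  have outer: "(\<chi> i l. x $ i * x $ l / c) *v y = ((x \<bullet> y) / c) *\<^sub>R x"
    for x y :: "real ^ 'r" and c
    by (simp add: vec_eq_iff matrix_vector_mult_def inner_vec_def sum_distrib_left
        sum_divide_distrib mult_ac)
  show ?thesis
    using assms
    by (simp add: spa_residual_def Let_def column_matrix_mul matrix_vector_mult_diff_rdistrib outer)
qed

section \<open>Exactness of the truncated SVD when the rank is at most two\<close>

lemma is_svd_mult_right_singular:
  fixes M :: "real ^ 'n ^ 'm"
  assumes "is_svd M u \<sigma> v" and "k < min CARD('m) CARD('n)"
  shows "M *v v k = \<sigma> k *\<^sub>R u k"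
proof -
  let ?r = "min CARD('m) CARD('n)"
  have M: "M = (\<chi> a b. \<Sum>i<?r. \<sigma> i * u i $ a * v i $ b)"
    and v: "\<And>i. i < ?r \<Longrightarrow> v i \<bullet> v k = (if i = k then 1 else 0)"
    using assms by (auto simp: is_svd_def Let_def)
  have "(M *v v k) $ a = \<sigma> k * u k $ a" for a
  proof -
    have "(M *v v k) $ a = (\<Sum>b\<in>UNIV. \<Sum>i<?r. \<sigma> i * u i $ a * v i $ b * v k $ b)"
      by (subst M) (simp add: matrix_vector_mult_def sum_distrib_right)
    also have "\<dots> = (\<Sum>i<?r. \<sigma> i * u i $ a * (v i \<bullet> v k))"
      by (subst sum.swap) (simp add: inner_vec_def sum_distrib_left mult_ac)
    also have "\<dots> = (\<Sum>i<?r. if i = k then \<sigma> i * u i $ a else 0)"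
      by (intro sum.cong refl) (simp add: v)
    finally show ?thesis using assms(2) by simp
  qed
  then show ?thesis by (simp add: vec_eq_iff)
qed

text \<open>A nonzero \<open>\<sigma> k\<close> would put the \<open>k + 1 \<ge> 3\<close>
  orthonormal vectors \<open>u 0, ..., u k\<close> into the column space of \<open>P\<close>, which
  is spanned by two vectors.\<close>

lemma is_svd_rank_two_singular_values:
  fixes M :: "real ^ 'n ^ 'm" and P :: "real ^ 2 ^ 'm" and Q :: "real ^ 'n ^ 2"
  assumes svd: "is_svd M u \<sigma> v" and M: "M = P ** Q"
    and k: "2 \<le> k" "k < min CARD('m) CARD('n)"
  shows "\<sigma> k = 0"
proof (rule ccontr)
  assume "\<sigma> k \<noteq> 0"
  have orth: "\<And>i j. i \<le> k \<Longrightarrow> j \<le> k \<Longrightarrow> u i \<bullet> u j = (if i = j then 1 else 0)"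
    using svd k(2) unfolding is_svd_def Let_def by (meson le_less_trans)
  have "0 \<le> \<sigma> k" and dec: "\<And>i. i \<le> k \<Longrightarrow> \<sigma> k \<le> \<sigma> i"
    using svd k(2) unfolding is_svd_def Let_def by (auto intro: le_less_trans)
  \<comment> \<open>The decreasing order carries positivity from \<open>\<sigma> k\<close> to all
    earlier singular values, so each of them can be divided out below.\<close>
  with \<open>\<sigma> k \<noteq> 0\<close> have pos: "\<And>i. i \<le> k \<Longrightarrow> 0 < \<sigma> i" by (smt (verit))
  have in_span: "u i \<in> span {column 1 P, column 2 P}" if "i \<le> k" for i
  proof -
    have "\<sigma> i *\<^sub>R u i = P *v (Q *v v i)"
      using is_svd_mult_right_singular[OF svd, of i] that k(2)
      by (simp add: M matrix_vector_mul_assoc)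
    then have "\<sigma> i *\<^sub>R u i \<in> span {column 1 P, column 2 P}"
      by (simp add: matrix_vector_mult_2 span_add span_scale span_base)
    then have "(1 / \<sigma> i) *\<^sub>R (\<sigma> i *\<^sub>R u i) \<in> span {column 1 P, column 2 P}"
      by (rule span_scale)
    with pos[OF that] show ?thesis by simp
  qed
  \<comment> \<open>Needed to count: the image has exactly \<open>k + 1\<close> elements.\<close>
  have inj: "inj_on u {..k}"
    using orth by (intro inj_onI) (metis atMost_iff zero_neq_one)
  have "pairwise orthogonal (u ` {..k})" "0 \<notin> u ` {..k}"
    using orth by (auto simp: pairwise_def orthogonal_def) (metis inner_zero_left zero_neq_one)
  then have "independent (u ` {..k})" by (rule pairwise_orthogonal_independent)
  moreover have "u ` {..k} \<subseteq> span {column 1 P, column 2 P}" using in_span by auto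
  ultimately have "card (u ` {..k}) \<le> card {column 1 P, column 2 P}"
    by (intro conjunct2[OF independent_span_bound]) simp_all
  also have "\<dots> \<le> 2" by (simp add: card_insert_if)
  finally show False using k(1) by (simp add: card_image[OF inj])
qed

text \<open>Truncation drops only terms whose singular value vanishes. Orthonormality of the columns
  of \<open>U\<close> later allows \<open>X\<close> to be recovered from \<open>M\<close>.\<close>

lemma is_rank_two_svd_exact:
  fixes M :: "real ^ 'n ^ 'm" and P :: "real ^ 2 ^ 'm" and Q :: "real ^ 'n ^ 2"
  assumes dims: "CARD('m) \<ge> 2" "CARD('n) \<ge> 2"
    and "is_rank_two_svd M U S V" and M: "M = P ** Q"
  shows "M = U ** (S ** V)" and "transpose U ** U = mat 1"
proof -
  let ?r = "min CARD('m) CARD('n)"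
  obtain u \<sigma> v where svd: "is_svd M u \<sigma> v" and U: "column 1 U = u 0" "column 2 U = u 1"
    and S: "S $ 1 $ 1 = \<sigma> 0" "S $ 2 $ 2 = \<sigma> 1" "S $ 1 $ 2 = 0" "S $ 2 $ 1 = 0"
    and V: "row 1 V = v 0" "row 2 V = v 1"
    using assms(3) unfolding is_rank_two_svd_def by blast
  have Meq: "M = (\<chi> a b. \<Sum>i<?r. \<sigma> i * u i $ a * v i $ b)"
    and orth: "\<And>i j. i < ?r \<Longrightarrow> j < ?r \<Longrightarrow> u i \<bullet> u j = (if i = j then 1 else 0)"
    using svd unfolding is_svd_def Let_def by auto
  have r: "2 \<le> ?r" using dims by simp
  have u: "U $ a $ 1 = u 0 $ a" "U $ a $ 2 = u 1 $ a" for a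
    using U by (auto simp: column_def vec_eq_iff)
  have v: "V $ 1 $ b = v 0 $ b" "V $ 2 $ b = v 1 $ b" for b
    using V by (auto simp: row_def vec_eq_iff)
  have "M $ a $ b = (U ** (S ** V)) $ a $ b" for a b
  proof -
    have "M $ a $ b = (\<Sum>i<?r. \<sigma> i * u i $ a * v i $ b)" by (subst Meq) simp
    also have "\<dots> = (\<Sum>i<2. \<sigma> i * u i $ a * v i $ b)"
      using r is_svd_rank_two_singular_values[OF svd M]
      by (intro sum.mono_neutral_right) auto
    finally show ?thesis
      by (simp add: matrix_matrix_mult_def sum_2 S u v numeral_2_eq_2 algebra_simps)
  qed
  then show "M = U ** (S ** V)" by (simp add: vec_eq_iff)
  have "u 0 \<bullet> u 0 = 1" "u 0 \<bullet> u 1 = 0" "u 1 \<bullet> u 0 = 0" "u 1 \<bullet> u 1 = 1"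
    using orth r by auto
  then show "transpose U ** U = mat 1"
    by (simp add: vec_eq_iff matrix_matrix_mult_def transpose_def mat_def forall_2 u inner_vec_def)
qed

section \<open>SPA on points of a segment\<close>

text \<open>
  In \<open>x j = x k1 + t j (a - b)\<close>, maximality of the norm of \<open>x k1\<close> forces all the \<open>t j\<close> to have the
  same sign.
\<close>

lemma spa_segment:
  fixes x :: "'i \<Rightarrow> 'a::real_inner"
  assumes seg: "\<And>j. x j = h j *\<^sub>R a + (1 - h j) *\<^sub>R b"
    and k1: "\<And>j. norm (x j) \<le> norm (x k1)"
    and k2: "\<And>j. x k1 \<noteq> 0 \<Longrightarrow>
      norm (x j - ((x k1 \<bullet> x j) / (norm (x k1))\<^sup>2) *\<^sub>R x k1) \<le>
      norm (x k2 - ((x k1 \<bullet> x k2) / (norm (x k1))\<^sup>2) *\<^sub>R x k1)"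
  shows "(\<forall>j. \<exists>s. 0 \<le> s \<and> s \<le> 1 \<and> x j = (1 - s) *\<^sub>R x k1 + s *\<^sub>R x k2)
    \<or> (\<forall>j. \<exists>c. x j = c *\<^sub>R x k1)"
proof -
  define p where "p = x k1"
  define d where "d = a - b"
  define t where "t = (\<lambda>j. h j - h k1)"
  \<comment> \<open>The component of \<open>d\<close> orthogonal to \<open>p\<close>; the SPA
    residual of \<open>x j\<close> will be \<open>t j *\<^sub>R e\<close>.\<close>
  define e where "e = d - ((p \<bullet> d) / (norm p)\<^sup>2) *\<^sub>R p"
  have x: "x j = p + t j *\<^sub>R d" for j
    unfolding p_def d_def t_def seg[of j] seg[of k1] by (simp add: algebra_simps)
  consider "p = 0" | "p \<noteq> 0" "e = 0" | "p \<noteq> 0" "e \<noteq> 0" by blast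
  then show ?thesis
  proof cases
    case 1
    then have "x j = 0" for j using k1[of j] by (simp add: p_def)
    then show ?thesis by simp
  next
    \<comment> \<open>Here \<open>d\<close> is parallel to \<open>p\<close>, so the line through the
      points passes through the origin.\<close>
    case 2
    have "x j = (1 + t j * ((p \<bullet> d) / (norm p)\<^sup>2)) *\<^sub>R p" for j
    proof -
      have "d = ((p \<bullet> d) / (norm p)\<^sup>2) *\<^sub>R p" using 2(2) by (simp add: e_def)
      then have "x j = p + t j *\<^sub>R (((p \<bullet> d) / (norm p)\<^sup>2) *\<^sub>R p)" using x by metis
      then show ?thesis by (simp add: algebra_simps)
    qed
    then show ?thesis unfolding p_def by blast
  next
    case 3
    have "d \<noteq> 0" using 3(2) by (auto simp: e_def)
    have resid: "x j - ((p \<bullet> x j) / (norm p)\<^sup>2) *\<^sub>R p = t j *\<^sub>R e" for j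
    proof -
      have "(p \<bullet> x j) / (norm p)\<^sup>2 = 1 + t j * ((p \<bullet> d) / (norm p)\<^sup>2)"
        using 3(1) by (simp add: x inner_add_right power2_norm_eq_inner field_simps)
      then show ?thesis by (simp add: x e_def algebra_simps)
    qed
    have tmax: "\<bar>t j\<bar> \<le> \<bar>t k2\<bar>" for j
      using k2[of j] 3 resid[of j] resid[of k2] by (simp add: p_def)
    \<comment> \<open>Expand the squared norm of \<open>p + t j *\<^sub>R d\<close> and cancel that
      of \<open>p\<close>. Since \<open>d \<bullet> d > 0\<close>, a nonzero \<open>t j\<close> must
      have the sign opposite to \<open>p \<bullet> d\<close>.\<close>
    have quad: "t j * (2 * (p \<bullet> d) + t j * (d \<bullet> d)) \<le> 0" for j
    proof -
      have "(norm (x j))\<^sup>2 \<le> (norm p)\<^sup>2" using k1[of j] by (simp add: p_def)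
      then show ?thesis
        by (simp add: x power2_norm_eq_inner inner_add inner_commute algebra_simps)
    qed
    have dd: "0 < d \<bullet> d" using \<open>d \<noteq> 0\<close> by simp
    have pos: "p \<bullet> d < 0" if "0 < t j" for j
    proof -
      have "2 * (p \<bullet> d) + t j * (d \<bullet> d) \<le> 0" using quad[of j] that by (simp add: mult_le_0_iff)
      with mult_pos_pos[OF that dd] show ?thesis by linarith
    qed
    have neg: "0 < p \<bullet> d" if "t j < 0" for j
    proof -
      have "0 \<le> 2 * (p \<bullet> d) + t j * (d \<bullet> d)" using quad[of j] that by (simp add: mult_le_0_iff)
      with mult_neg_pos[OF that dd] show ?thesis by linarith
    qed
    have sign: "0 \<le> t j * t k2" for j
      using pos[of j] pos[of k2] neg[of j] neg[of k2]
      by (cases "t j" "0::real" rule: linorder_cases; cases "t k2" "0::real" rule: linorder_cases)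
        (auto simp: mult_nonneg_nonneg mult_nonpos_nonpos)
    have "\<exists>s. 0 \<le> s \<and> s \<le> 1 \<and> x j = (1 - s) *\<^sub>R x k1 + s *\<^sub>R x k2" for j
    proof (intro exI conjI)
      \<comment> \<open>The weight is the position of \<open>x j\<close> relative to
        \<open>x k2\<close>. If \<open>t k2 = 0\<close>, then \<open>tmax\<close> makes every
        \<open>t j\<close> zero, and the convention \<open>0 / 0 = 0\<close> gives the correct
        weight.\<close>
      show "0 \<le> t j / t k2" using sign[of j] by (auto simp: zero_le_divide_iff zero_le_mult_iff)
      then show "t j / t k2 \<le> 1"
        using tmax[of j] by (auto simp: divide_le_eq zero_le_divide_iff split: if_splits)
      have "t j = (t j / t k2) * t k2" using tmax[of j] by auto
      then have "x j = p + ((t j / t k2) * t k2) *\<^sub>R d" using x by metis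
      then show "x j = (1 - t j / t k2) *\<^sub>R x k1 + (t j / t k2) *\<^sub>R x k2"
        unfolding x[of k2] p_def[symmetric] scaleR_add_right scaleR_scaleR
        by (simp only: scaleR_left_diff_distrib scaleR_one) simp
    qed
    then show ?thesis by blast
  qed
qed

lemma spa_two_segment:
  fixes X :: "real ^ 'n ^ 'r"
  assumes seg: "\<And>j. column j X = h j *\<^sub>R a + (1 - h j) *\<^sub>R b" and spa: "spa_two X k1 k2"
  shows "(\<forall>j. \<exists>s. 0 \<le> s \<and> s \<le> 1 \<and> column j X = (1 - s) *\<^sub>R column k1 X + s *\<^sub>R column k2 X)
    \<or> (\<forall>j. \<exists>c. column j X = c *\<^sub>R column k1 X)"
proof (rule spa_segment[OF seg])
  show "norm (column j X) \<le> norm (column k1 X)" for j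
    using spa by (simp add: spa_two_def is_arg_max_linorder)
  show "norm (column j X - ((column k1 X \<bullet> column j X) / (norm (column k1 X))\<^sup>2) *\<^sub>R column k1 X) \<le>
      norm (column k2 X - ((column k1 X \<bullet> column k2 X) / (norm (column k1 X))\<^sup>2) *\<^sub>R column k1 X)"
    if "column k1 X \<noteq> 0" for j
    using spa that by (simp add: spa_two_def is_arg_max_linorder column_spa_residual)
qed

section \<open>From nonnegative combinations to an optimal factorization\<close>

text \<open>A negative coefficient forces opposite signs in every entry, so \<open>y\<close>
  vanishes and the coefficient can be replaced by zero.\<close>

lemma nonneg_multiple:
  fixes x y :: "real ^ 'm"
  assumes "0 \<le> x" and "0 \<le> y" and "y = c *\<^sub>R x"
  obtains d where "0 \<le> d" and "y = d *\<^sub>R x"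
proof (cases "0 \<le> c")
  case False
  have "y $ i = 0" for i
  proof -
    have "0 \<le> x $ i" "0 \<le> y $ i" using assms(1,2) by (auto simp: less_eq_vec_def)
    with False show ?thesis by (simp add: assms(3) zero_le_mult_iff)
  qed
  then have "y = 0 *\<^sub>R x" by (simp add: vec_eq_iff)
  then show ?thesis using that by blast
qed (use assms that in blast)

lemma nmf_from_selected_columns:
  fixes M :: "real ^ 'n ^ 'm"
  assumes "\<And>j. \<exists>c d. 0 \<le> c \<and> 0 \<le> d \<and> column j M = c *\<^sub>R column k1 M + d *\<^sub>R column k2 M"
  shows "\<exists>Y\<ge>0. M = select_columns M k1 k2 ** Y"
proof -
  obtain c d where cd: "\<And>j. 0 \<le> c j" "\<And>j. 0 \<le> d j"
    "\<And>j. column j M = c j *\<^sub>R column k1 M + d j *\<^sub>R column k2 M"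
    using assms by metis
  define Y :: "real ^ 'n ^ 2" where "Y = (\<chi> i j. if i = 1 then c j else d j)"
  have Y: "column j Y $ 1 = c j" "column j Y $ 2 = d j" for j
    by (simp_all add: Y_def column_def)
  then have "M = select_columns M k1 k2 ** Y"
    unfolding column_eq_iff[of M] column_matrix_mul matrix_vector_mult_2 column_select_columns Y
    using cd(3) by blast
  moreover have "0 \<le> Y" using cd by (simp add: matrix_nonneg_iff Y_def)
  ultimately show ?thesis by blast
qed

text \<open>The exact factor \<open>Y\<close> competes with \<open>H\<close>, so the error of
  \<open>H\<close> is zero, and no pair can have a smaller squared norm.\<close>

lemma optimal_rank_two_nmf_exact:
  assumes "0 \<le> W" and "is_arg_min (\<lambda>Y. (norm (M - W ** Y))\<^sup>2) (\<lambda>Y. 0 \<le> Y) H"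
    and "0 \<le> Y" and "M = W ** Y"
  shows "optimal_rank_two_nmf M W H"
proof -
  have "0 \<le> H" and "(norm (M - W ** H))\<^sup>2 \<le> (norm (M - W ** Y))\<^sup>2"
    using assms(2,3) by (auto simp: is_arg_min_linorder)
  then have "M = W ** H" using assms(4) by simp
  then show ?thesis
    using assms(1) \<open>0 \<le> H\<close> by (auto simp: optimal_rank_two_nmf_def is_arg_min_linorder)
qed

theorem corollary1:
  fixes M :: "real ^ 'n ^ 'm"
    and Wt :: "real ^ 2 ^ 'm"
    and Ht :: "real ^ 'n ^ 2"
    and W :: "real ^ 2 ^ 'm"
    and H :: "real ^ 'n ^ 2"
  assumes "CARD('m) \<ge> 2" and "CARD('n) \<ge> 2"
    and "0 \<le> M"
    and "0 \<le> Wt" and "0 \<le> Ht"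
    and "M = Wt ** Ht"
    and "\<forall>j. (\<Sum>i\<in>UNIV. Ht $ i $ j) = 1"
    and "rank_two_nmf_output M W H"
  shows "optimal_rank_two_nmf M W H"
proof -
  obtain U S V k1 k2 where svd: "is_rank_two_svd M U S V"
    and spa: "spa_two (S ** V) k1 k2"
    and W: "W = positive_part (U ** S ** select_columns V k1 k2)"
    and H: "is_arg_min (\<lambda>Y. (norm (M - W ** Y))\<^sup>2) (\<lambda>Y. 0 \<le> Y) H"
    using assms(8) unfolding rank_two_nmf_output_def by blast
  define X where "X = S ** V"
  have MUX: "M = U ** X" and UU: "transpose U ** U = mat 1"
    using is_rank_two_svd_exact[OF assms(1,2) svd assms(6)] by (simp_all add: X_def)
  have M_nonneg: "0 \<le> M $ i $ j" for i j using assms(3) by (simp add: matrix_nonneg_iff)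
  \<comment> \<open>By exactness of the SVD, the product inside \<open>positive_part\<close>
    consists of columns of \<open>M\<close>, which are already nonnegative.\<close>
  have W_eq: "W = select_columns M k1 k2"
  proof -
    have "W = positive_part (select_columns M k1 k2)"
      by (simp add: W matrix_mul_select_columns MUX X_def matrix_mul_assoc)
    also have "\<dots> = select_columns M k1 k2"
      by (rule positive_part_nonneg) (simp add: select_columns_def M_nonneg)
    finally show ?thesis .
  qed
  have colM: "column j M = U *v column j X" for j by (simp add: MUX column_matrix_mul)
  \<comment> \<open>The sum-to-one constraint places the columns of \<open>M\<close> on the segment
    between the columns of \<open>Wt\<close>; the linear map \<open>transpose U\<close> carries this
    over to \<open>X\<close>.\<close>
  have "column j X = Ht $ 1 $ j *\<^sub>R (transpose U *v column 1 Wt)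
      + (1 - Ht $ 1 $ j) *\<^sub>R (transpose U *v column 2 Wt)" for j
  proof -
    have "Ht $ 2 $ j = 1 - Ht $ 1 $ j" using assms(7) by (simp add: sum_2 eq_diff_eq add.commute)
    then have "column j M = Ht $ 1 $ j *\<^sub>R column 1 Wt + (1 - Ht $ 1 $ j) *\<^sub>R column 2 Wt"
      by (simp add: assms(6) column_matrix_mul matrix_vector_mult_2[of Wt]) (simp add: column_def)
    moreover have "column j X = transpose U *v column j M"
      by (simp add: colM matrix_vector_mul_assoc UU)
    ultimately show ?thesis
      by (simp add: matrix_vector_right_distrib matrix_vector_mult_scaleR)
  qed
  from spa_two_segment[OF this spa[folded X_def]]
  have comb: "\<exists>c d. 0 \<le> c \<and> 0 \<le> d \<and> column j M = c *\<^sub>R column k1 M + d *\<^sub>R column k2 M" for j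
  proof (elim disjE)
    assume "\<forall>j. \<exists>s. 0 \<le> s \<and> s \<le> 1 \<and> column j X = (1 - s) *\<^sub>R column k1 X + s *\<^sub>R column k2 X"
    then obtain s where "0 \<le> s" "s \<le> 1"
      "column j X = (1 - s) *\<^sub>R column k1 X + s *\<^sub>R column k2 X" by blast
    then have "0 \<le> 1 - s" "0 \<le> s" "column j M = (1 - s) *\<^sub>R column k1 M + s *\<^sub>R column k2 M"
      by (simp_all add: colM matrix_vector_right_distrib matrix_vector_mult_scaleR)
    then show ?thesis by blast
  next
    \<comment> \<open>The scalar \<open>c\<close> may be negative, as \<open>X\<close> can have
      entries of any sign; nonnegativity is regained only after mapping back to the columns of
      \<open>M\<close>.\<close>
    assume "\<forall>j. \<exists>c. column j X = c *\<^sub>R column k1 X"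
    then obtain c where "column j X = c *\<^sub>R column k1 X" by blast
    then have c: "column j M = c *\<^sub>R column k1 M" by (simp add: colM matrix_vector_mult_scaleR)
    have "0 \<le> column k M" for k using M_nonneg by (simp add: less_eq_vec_def column_def)
    then obtain d where "0 \<le> d" "column j M = d *\<^sub>R column k1 M"
      using nonneg_multiple[OF _ _ c] by blast
    then have "0 \<le> d \<and> 0 \<le> (0::real) \<and> column j M = d *\<^sub>R column k1 M + 0 *\<^sub>R column k2 M"
      by simp
    then show ?thesis by blast
  qed
  obtain Y where "0 \<le> Y" "M = W ** Y"
    using nmf_from_selected_columns[OF comb] unfolding W_eq by blast
  moreover have "0 \<le> W" using M_nonneg by (simp add: W_eq matrix_nonneg_iff select_columns_def)
  ultimately show ?thesis using optimal_rank_two_nmf_exact H by blast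
qed

end
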